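(* Assume that $\mathcal{E}\neq\{0\}$ is a Hilbert space and $n=1$. Then an odometer map $W_L\in\mathcal{B}(\mathcal{F}_1^2\otimes\mathcal{E})$ is compact if and only if $W_L=0$.
   Context: Hilbert spaces are separable and complex. For $n=1$ the full Fock space $\mathcal{F}_1^2=\mathbb{C}\Omega\oplus\bigoplus_{k\ge1}\mathbb{C}^{\otimes k}$ has orthonormal basis $\{e_1^m:m\ge0\}$, where $e_1^m=e_1^{\otimes m}$ and $e_1^0=\Omega$ is the vacuum vector. For $L\in\mathcal{B}(\mathcal{E},\mathcal{F}_1^2\otimes\mathcal{E})$ the odometer map $W_L$ on $\mathcal{F}_1^2\otimes\mathcal{E}$ with symbol $L$ is determined by $W_L(e_1^m\otimes\eta)=e_1^m\otimes L\eta$ for $m\ge0$, $\eta\in\mathcal{E}$, where $e_1^m\otimes f$ ($f\in\mathcal{F}_1^2\otimes\mathcal{E}$) means left tensoring by $e_1^m$. It is a standing assumption that $W_L$ is a bounded operator on $\mathcal{F}_1^2\otimes\mathcal{E}$. *)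

theory Defs
  imports "HOL-Analysis.Analysis"
begin

section \<open>Complex Hilbert spaces\<close>

text \<open>The distribution only has real inner product spaces. A complex Hilbert space is a complete
  space carrying a complex scalar multiplication and a sesquilinear form \<open>cinner\<close> (linear in the
  first argument), whose real part is the real inner product of the type. Consequently the norm is
  the usual one, see \<open>norm_eq_sqrt_cinner\<close>. Separability is not part of the class; it is imposed by
  the additional sort \<open>second_countable_topology\<close>.\<close>

class complex_hilbert = real_inner + complete_space +
  fixes scaleC :: "complex \<Rightarrow> 'a \<Rightarrow> 'a" (infixr \<open>*\<^sub>C\<close> 75)
    and cinner :: "'a \<Rightarrow> 'a \<Rightarrow> complex"
  assumes scaleC_add_right: "c *\<^sub>C (x + y) = c *\<^sub>C x + c *\<^sub>C y"
    and scaleC_add_left: "(c + d) *\<^sub>C x = c *\<^sub>C x + d *\<^sub>C x"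
    and scaleC_scaleC: "c *\<^sub>C d *\<^sub>C x = (c * d) *\<^sub>C x"
    and scaleC_of_real: "complex_of_real r *\<^sub>C x = r *\<^sub>R x"
    and cinner_commute: "cinner x y = cnj (cinner y x)"
    and cinner_add_left: "cinner (x + y) z = cinner x z + cinner y z"
    and cinner_scaleC_left: "cinner (c *\<^sub>C x) y = c * cinner x y"
    and inner_eq_Re_cinner: "inner x y = Re (cinner x y)"
begin

lemma cinner_self: "cinner x x = complex_of_real ((norm x)\<^sup>2)"
proof -
  have "Im (cinner x x) = 0"
    using arg_cong[OF cinner_commute[of x x], of Im] by simp
  thus ?thesis
    by (simp add: complex_eq_iff power2_norm_eq_inner inner_eq_Re_cinner)
qed

lemma norm_eq_sqrt_cinner: "norm x = sqrt (Re (cinner x x))"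
  by (simp add: norm_eq_sqrt_inner inner_eq_Re_cinner)

lemma cinner_scaleC_right: "cinner x (c *\<^sub>C y) = cnj c * cinner x y"
  by (metis cinner_commute cinner_scaleC_left complex_cnj_mult)

lemma norm_scaleC: "norm (c *\<^sub>C x) = cmod c * norm x"
proof -
  have "complex_of_real ((norm (c *\<^sub>C x))\<^sup>2) = c * cnj c * cinner x x"
    by (simp only: cinner_self[symmetric] cinner_scaleC_left cinner_scaleC_right ac_simps)
  also have "\<dots> = complex_of_real ((cmod c * norm x)\<^sup>2)"
    by (simp add: cinner_self complex_norm_square[symmetric] power_mult_distrib)
  finally have "(norm (c *\<^sub>C x))\<^sup>2 = (cmod c * norm x)\<^sup>2"
    using of_real_eq_iff by blast
  thus ?thesis
    by (simp add: power2_eq_iff_nonneg)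
qed

lemma norm_cinner_le: "cmod (cinner x y) \<le> norm x * norm y"
proof -
  define c where "c = cnj (sgn (cinner x y))"
  have c: "cmod c \<le> 1"
    by (simp add: c_def norm_sgn)
  have "c * cinner x y = complex_of_real (cmod (cinner x y))"
    by (cases "cinner x y = 0")
       (simp_all add: c_def sgn_eq mult.commute[of "cnj _"] complex_norm_square[symmetric]
          power2_eq_square)
  hence "cmod (cinner x y) = Re (cinner (c *\<^sub>C x) y)"
    by (simp add: cinner_scaleC_left)
  also have "\<dots> \<le> norm (c *\<^sub>C x) * norm y"
    using norm_cauchy_schwarz[of "c *\<^sub>C x" y] by (simp add: inner_eq_Re_cinner)
  also have "\<dots> \<le> norm x * norm y"
    using c by (simp add: norm_scaleC mult_right_mono mult_left_le_one_le)
  finally show ?thesis .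
qed

end

instantiation complex :: complex_hilbert
begin

definition scaleC_complex :: "complex \<Rightarrow> complex \<Rightarrow> complex" where
  "scaleC_complex c z = c * z"

definition cinner_complex :: "complex \<Rightarrow> complex \<Rightarrow> complex" where
  "cinner_complex z w = z * cnj w"

instance
  by standard
     (auto simp: scaleC_complex_def cinner_complex_def algebra_simps scaleR_conv_of_real
        inner_complex_def)

end

definition bounded_clinear :: "('a::complex_hilbert \<Rightarrow> 'b::complex_hilbert) \<Rightarrow> bool" where
  "bounded_clinear T \<longleftrightarrow> bounded_linear T \<and> (\<forall>c x. T (c *\<^sub>C x) = c *\<^sub>C T x)"

definition compact_operator :: "('a::complex_hilbert \<Rightarrow> 'b::complex_hilbert) \<Rightarrow> bool" where
  "compact_operator T \<longleftrightarrow> bounded_clinear T \<and> compact (closure (T ` cball 0 1))"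


section \<open>Hilbert sums of countably many copies of a Hilbert space\<close>

typedef (overloaded) ('a::complex_hilbert) ell2 =
  "{f :: nat \<Rightarrow> 'a. summable (\<lambda>k. (norm (f k))\<^sup>2)}"
  morphisms coord Abs_ell2
  by (rule exI[of _ "\<lambda>_. 0"]) simp

setup_lifting type_definition_ell2

lemma summable_coord: "summable (\<lambda>k. (norm (coord f k))\<^sup>2)"
  using coord[of f] by simp

lemma sq_norm_add_le: "(norm (x + y :: 'a::real_normed_vector))\<^sup>2 \<le> 2 * (norm x)\<^sup>2 + 2 * (norm y)\<^sup>2"
proof -
  have "(norm (x + y))\<^sup>2 \<le> (norm x + norm y)\<^sup>2"
    by (simp add: norm_triangle_ineq power_mono)
  also have "\<dots> \<le> 2 * (norm x)\<^sup>2 + 2 * (norm y)\<^sup>2"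
    using sum_squares_bound[of "norm x" "norm y"] by (simp add: power2_sum)
  finally show ?thesis .
qed

lemma summable_sq_add:
  fixes f g :: "nat \<Rightarrow> 'a::real_normed_vector"
  assumes "summable (\<lambda>k. (norm (f k))\<^sup>2)" "summable (\<lambda>k. (norm (g k))\<^sup>2)"
  shows "summable (\<lambda>k. (norm (f k + g k))\<^sup>2)"
proof (rule summable_comparison_test')
  show "summable (\<lambda>k. 2 * (norm (f k))\<^sup>2 + 2 * (norm (g k))\<^sup>2)"
    by (intro summable_add summable_mult assms)
  show "norm ((norm (f n + g n))\<^sup>2) \<le> 2 * (norm (f n))\<^sup>2 + 2 * (norm (g n))\<^sup>2" for n
    using sq_norm_add_le[of "f n" "g n"] by simp
qed

lemma summable_sq_finite_support:
  "(\<And>k. k \<ge> N \<Longrightarrow> f k = 0) \<Longrightarrow> summable (\<lambda>k. (norm (f k :: 'a::real_normed_vector))\<^sup>2)"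
  by (rule summable_finite[of "{..<N}"]) (auto simp: not_less)

lemma summable_cinner:
  assumes "summable (\<lambda>k. (norm (f k :: 'a::complex_hilbert))\<^sup>2)" "summable (\<lambda>k. (norm (g k))\<^sup>2)"
  shows "summable (\<lambda>k. cinner (f k) (g k))"
proof (rule summable_comparison_test')
  show "summable (\<lambda>k. (norm (f k))\<^sup>2 + (norm (g k))\<^sup>2)"
    by (intro summable_add assms)
  show "norm (cinner (f n) (g n)) \<le> (norm (f n))\<^sup>2 + (norm (g n))\<^sup>2" for n
  proof -
    have "2 * (norm (f n) * norm (g n)) \<le> (norm (f n))\<^sup>2 + (norm (g n))\<^sup>2"
      using sum_squares_bound[of "norm (f n)" "norm (g n)"] by (simp add: mult.assoc)
    moreover have "0 \<le> norm (f n) * norm (g n)"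
      by simp
    ultimately show ?thesis
      using norm_cinner_le[of "f n" "g n"] by linarith
  qed
qed

lemma summable_cinner_coord: "summable (\<lambda>k. cinner (coord f k) (coord g k))"
  by (intro summable_cinner summable_coord)

lemma summable_inner_coord: "summable (\<lambda>k. inner (coord f k) (coord g k))"
  using summable_Re[OF summable_cinner_coord[of f g]] by (simp add: inner_eq_Re_cinner)

instantiation ell2 :: (complex_hilbert) real_vector
begin

lift_definition zero_ell2 :: "'a ell2" is "\<lambda>_. 0" by simp
lift_definition plus_ell2 :: "'a ell2 \<Rightarrow> 'a ell2 \<Rightarrow> 'a ell2" is "\<lambda>f g k. f k + g k"
  by (rule summable_sq_add)
lift_definition uminus_ell2 :: "'a ell2 \<Rightarrow> 'a ell2" is "\<lambda>f k. - f k" by simp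
lift_definition minus_ell2 :: "'a ell2 \<Rightarrow> 'a ell2 \<Rightarrow> 'a ell2" is "\<lambda>f g k. f k - g k"
proof -
  fix f g :: "nat \<Rightarrow> 'a"
  assume "summable (\<lambda>k. (norm (f k))\<^sup>2)" "summable (\<lambda>k. (norm (g k))\<^sup>2)"
  thus "summable (\<lambda>k. (norm (f k - g k))\<^sup>2)"
    using summable_sq_add[of f "\<lambda>k. - g k"] by simp
qed
lift_definition scaleR_ell2 :: "real \<Rightarrow> 'a ell2 \<Rightarrow> 'a ell2" is "\<lambda>r f k. r *\<^sub>R f k"
  by (simp add: power_mult_distrib summable_mult)

instance
proof
  fix f g h :: "'a ell2" and r s :: real
  show "f + g + h = f + (g + h)" by transfer (simp add: add.assoc)
  show "f + g = g + f" by transfer (simp add: add.commute)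
  show "0 + f = f" by transfer simp
  show "- f + f = 0" by transfer simp
  show "f - g = f + - g" by transfer simp
  show "r *\<^sub>R (f + g) = r *\<^sub>R f + r *\<^sub>R g" by transfer (simp add: scaleR_add_right)
  show "(r + s) *\<^sub>R f = r *\<^sub>R f + s *\<^sub>R f" by transfer (simp add: scaleR_add_left)
  show "r *\<^sub>R s *\<^sub>R f = (r * s) *\<^sub>R f" by transfer simp
  show "1 *\<^sub>R f = f" by transfer simp
qed

end

instantiation ell2 :: (complex_hilbert) real_inner
begin

definition inner_ell2 :: "'a ell2 \<Rightarrow> 'a ell2 \<Rightarrow> real" where
  "inner_ell2 f g = (\<Sum>k. inner (coord f k) (coord g k))"
definition norm_ell2 :: "'a ell2 \<Rightarrow> real" where
  "norm_ell2 f = sqrt (inner f f)"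
definition sgn_ell2 :: "'a ell2 \<Rightarrow> 'a ell2" where
  "sgn_ell2 f = f /\<^sub>R norm f"
definition dist_ell2 :: "'a ell2 \<Rightarrow> 'a ell2 \<Rightarrow> real" where
  "dist_ell2 f g = norm (f - g)"
definition uniformity_ell2 :: "('a ell2 \<times> 'a ell2) filter" where
  "uniformity_ell2 = (INF e\<in>{0<..}. principal {(x, y). dist x y < e})"
definition open_ell2 :: "'a ell2 set \<Rightarrow> bool" where
  "open_ell2 U \<longleftrightarrow> (\<forall>x\<in>U. eventually (\<lambda>(x', y). x' = x \<longrightarrow> y \<in> U) uniformity)"

instance
proof
  fix f g h :: "'a ell2" and r :: real
  show "dist f g = norm (f - g)" by (rule dist_ell2_def)
  show "sgn f = f /\<^sub>R norm f" by (rule sgn_ell2_def)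
  show "uniformity = (INF e\<in>{0<..}. principal {(x :: 'a ell2, y). dist x y < e})"
    by (rule uniformity_ell2_def)
  show "open U \<longleftrightarrow> (\<forall>x\<in>U. \<forall>\<^sub>F (x', y) in uniformity. x' = x \<longrightarrow> y \<in> U)" for U :: "'a ell2 set"
    by (rule open_ell2_def)
  show "inner f g = inner g f" by (simp add: inner_ell2_def inner_commute)
  show "inner (f + g) h = inner f h + inner g h"
    by (simp add: inner_ell2_def plus_ell2.rep_eq inner_add_left suminf_add summable_inner_coord)
  show "inner (r *\<^sub>R f) g = r * inner f g"
    by (simp add: inner_ell2_def scaleR_ell2.rep_eq suminf_mult summable_inner_coord)
  show "0 \<le> inner f f"
    by (simp add: inner_ell2_def suminf_nonneg summable_inner_coord)
  show "inner f f = 0 \<longleftrightarrow> f = 0"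
    by (simp add: inner_ell2_def suminf_eq_zero_iff summable_inner_coord
        coord_inject[symmetric] zero_ell2.rep_eq fun_eq_iff)
  show "norm f = sqrt (inner f f)" by (rule norm_ell2_def)
qed

end

lemma norm_ell2_sq: "(norm f)\<^sup>2 = (\<Sum>k. (norm (coord f k))\<^sup>2)"
  by (simp add: power2_norm_eq_inner inner_ell2_def)

lemma sum_coord_le: "finite A \<Longrightarrow> (\<Sum>k\<in>A. (norm (coord f k))\<^sup>2) \<le> (norm f)\<^sup>2"
  unfolding norm_ell2_sq by (rule sum_le_suminf) (auto simp: summable_coord)

lemma norm_coord_le: "norm (coord f k) \<le> norm f"
  using sum_coord_le[of "{k}" f] by (simp add: power2_le_iff_abs_le)

lemma ell2_leI:
  assumes "\<And>n. (\<Sum>k<n. (norm (f k))\<^sup>2) \<le> e\<^sup>2" "e \<ge> 0"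
  shows "summable (\<lambda>k. (norm (f k))\<^sup>2) \<and> norm (Abs_ell2 f) \<le> e"
proof
  show s: "summable (\<lambda>k. (norm (f k))\<^sup>2)"
  proof (rule bounded_imp_summable)
    show "(\<Sum>k\<le>n. (norm (f k))\<^sup>2) \<le> e\<^sup>2" for n
      using assms(1)[of "Suc n"] by (simp only: lessThan_Suc_atMost)
  qed simp
  hence "(norm (Abs_ell2 f))\<^sup>2 \<le> e\<^sup>2"
    by (simp add: norm_ell2_sq Abs_ell2_inverse suminf_le_const assms(1))
  thus "norm (Abs_ell2 f) \<le> e"
    using assms(2) by (rule power2_le_imp_le)
qed

instantiation ell2 :: (complex_hilbert) complex_hilbert
begin

lift_definition scaleC_ell2 :: "complex \<Rightarrow> 'a ell2 \<Rightarrow> 'a ell2" is "\<lambda>c f k. c *\<^sub>C f k"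
  by (simp add: norm_scaleC power_mult_distrib summable_mult)

definition cinner_ell2 :: "'a ell2 \<Rightarrow> 'a ell2 \<Rightarrow> complex" where
  "cinner_ell2 f g = (\<Sum>k. cinner (coord f k) (coord g k))"

instance
proof
  fix X :: "nat \<Rightarrow> 'a ell2"
  assume X: "Cauchy X"
  have "Cauchy (\<lambda>i. coord (X i) k)" for k
  proof (rule metric_CauchyI)
    fix e :: real assume "e > 0"
    then obtain M where M: "\<And>m n. m \<ge> M \<Longrightarrow> n \<ge> M \<Longrightarrow> dist (X m) (X n) < e"
      using metric_CauchyD[OF X] by blast
    have "dist (coord (X m) k) (coord (X n) k) < e" if "m \<ge> M" "n \<ge> M" for m n
      using M[OF that] norm_coord_le[of "X m - X n" k]
      by (simp add: dist_norm minus_ell2.rep_eq)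
    thus "\<exists>M. \<forall>m\<ge>M. \<forall>n\<ge>M. dist (coord (X m) k) (coord (X n) k) < e" by blast
  qed
  hence "\<forall>k. \<exists>l. (\<lambda>i. coord (X i) k) \<longlonglongrightarrow> l"
    using Cauchy_convergent convergent_def by blast
  then obtain g where g: "\<And>k. (\<lambda>i. coord (X i) k) \<longlonglongrightarrow> g k" by metis
  have bound: "summable (\<lambda>k. (norm (coord (X m) k - g k))\<^sup>2) \<and>
      norm (Abs_ell2 (\<lambda>k. coord (X m) k - g k)) \<le> e"
    if "e > 0" and M: "\<And>m n. m \<ge> M \<Longrightarrow> n \<ge> M \<Longrightarrow> dist (X m) (X n) < e" and m: "m \<ge> M" for e M m
  proof (rule ell2_leI)
    fix n
    have lim: "(\<lambda>i. \<Sum>k<n. (norm (coord (X m) k - coord (X i) k))\<^sup>2)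
        \<longlonglongrightarrow> (\<Sum>k<n. (norm (coord (X m) k - g k))\<^sup>2)"
      by (intro tendsto_sum tendsto_power tendsto_norm tendsto_diff tendsto_const g)
    have "(\<Sum>k<n. (norm (coord (X m) k - coord (X i) k))\<^sup>2) \<le> e\<^sup>2" if i: "i \<ge> M" for i
    proof -
      have "(\<Sum>k<n. (norm (coord (X m) k - coord (X i) k))\<^sup>2) \<le> (norm (X m - X i))\<^sup>2"
        using sum_coord_le[of "{..<n}" "X m - X i"] by (simp add: minus_ell2.rep_eq)
      also have "\<dots> \<le> e\<^sup>2"
        using M[OF m i] by (intro power_mono) (auto simp: dist_norm)
      finally show ?thesis .
    qed
    thus "(\<Sum>k<n. (norm (coord (X m) k - g k))\<^sup>2) \<le> e\<^sup>2"
      by (intro LIMSEQ_le_const2[OF lim]) auto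
  qed (use \<open>e > 0\<close> in simp)
  obtain M1 where M1: "\<And>m n. m \<ge> M1 \<Longrightarrow> n \<ge> M1 \<Longrightarrow> dist (X m) (X n) < 1"
    using metric_CauchyD[OF X, of 1] by auto
  have "summable (\<lambda>k. (norm (coord (X M1) k + - (coord (X M1) k - g k)))\<^sup>2)"
    by (rule summable_sq_add[OF summable_coord])
       (use bound[OF _ M1, of M1] in \<open>simp add: norm_minus_commute\<close>)
  hence gs: "summable (\<lambda>k. (norm (g k))\<^sup>2)" by simp
  have "X \<longlonglongrightarrow> Abs_ell2 g"
  proof (rule metric_LIMSEQ_I)
    fix e :: real assume e: "e > 0"
    then obtain M where M: "\<And>m n. m \<ge> M \<Longrightarrow> n \<ge> M \<Longrightarrow> dist (X m) (X n) < e / 2"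
      using metric_CauchyD[OF X, of "e / 2"] by auto
    have "dist (X m) (Abs_ell2 g) < e" if "m \<ge> M" for m
    proof -
      have "coord (X m - Abs_ell2 g) = (\<lambda>k. coord (X m) k - g k)"
        by (simp add: minus_ell2.rep_eq Abs_ell2_inverse gs)
      hence "X m - Abs_ell2 g = Abs_ell2 (\<lambda>k. coord (X m) k - g k)"
        by (metis coord_inverse)
      thus ?thesis
        using bound[OF _ M that] e by (simp add: dist_norm)
    qed
    thus "\<exists>M. \<forall>m\<ge>M. dist (X m) (Abs_ell2 g) < e" by blast
  qed
  thus "convergent X" by (rule convergentI)
next
  fix f g h :: "'a ell2" and c d :: complex and r :: real
  show "c *\<^sub>C (f + g) = c *\<^sub>C f + c *\<^sub>C g" by transfer (simp add: scaleC_add_right)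
  show "(c + d) *\<^sub>C f = c *\<^sub>C f + d *\<^sub>C f" by transfer (simp add: scaleC_add_left)
  show "c *\<^sub>C d *\<^sub>C f = (c * d) *\<^sub>C f" by transfer (simp add: scaleC_scaleC)
  show "complex_of_real r *\<^sub>C f = r *\<^sub>R f" by transfer (simp add: scaleC_of_real)
  show "cinner f g = cnj (cinner g f)"
  proof -
    have "cnj (\<Sum>k. cinner (coord g k) (coord f k)) = (\<Sum>k. cnj (cinner (coord g k) (coord f k)))"
      by (rule bounded_linear.suminf[OF bounded_linear_cnj summable_cinner_coord])
    thus ?thesis
      unfolding cinner_ell2_def by (simp add: cinner_commute[symmetric])
  qed
  show "cinner (f + g) h = cinner f h + cinner g h"
    by (simp add: cinner_ell2_def plus_ell2.rep_eq cinner_add_left suminf_add summable_cinner_coord)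
  show "cinner (c *\<^sub>C f) g = c * cinner f g"
    by (simp add: cinner_ell2_def scaleC_ell2.rep_eq cinner_scaleC_left suminf_mult
        summable_cinner_coord)
  show "inner f g = Re (cinner f g)"
  proof -
    have "Re (\<Sum>k. cinner (coord f k) (coord g k)) = (\<Sum>k. Re (cinner (coord f k) (coord g k)))"
      by (rule bounded_linear.suminf[OF bounded_linear_Re summable_cinner_coord])
    thus ?thesis
      by (simp add: cinner_ell2_def inner_ell2_def inner_eq_Re_cinner)
  qed
qed

end


section \<open>The full Fock space over a one-dimensional space, and its tensor products\<close>

text \<open>Since \<open>\<complex>\<^sup>\<otimes>\<^sup>k\<close> is one-dimensional with unit vector \<open>e\<^sub>1\<^sup>k\<close>, the full Fock space is the Hilbert
  sum of copies of the complex numbers indexed by \<open>k \<ge> 0\<close>.\<close>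

type_synonym fock1 = "complex ell2"

lift_definition fock_basis :: "nat \<Rightarrow> fock1" is "\<lambda>m k. if k = m then 1 else 0"
proof -
  show "summable (\<lambda>k. (norm (if k = m then 1 else 0 :: complex))\<^sup>2)" for m :: nat
    by (rule summable_sq_finite_support[of "Suc m"]) auto
qed

text \<open>The Hilbert space tensor product of \<open>fock1\<close> with \<open>'a\<close> is realised on \<open>'a ell2\<close>, the Hilbert
  sum of the copies \<open>e\<^sub>1\<^sup>k \<otimes> 'a\<close>. The lemmas below show that this is a Hilbert space tensor product:
  the map \<open>fock_tensor\<close> is bilinear, multiplicative on inner products, and has total range.\<close>

lift_definition fock_tensor :: "fock1 \<Rightarrow> 'a::complex_hilbert \<Rightarrow> 'a ell2" (infixr \<open>\<otimes>\<^sub>F\<close> 76)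
  is "\<lambda>x \<eta> k. x k *\<^sub>C \<eta>"
  by (simp add: norm_scaleC power_mult_distrib summable_mult2)

text \<open>Left tensoring by \<open>e\<^sub>1\<^sup>m\<close>, i.e. the isometry of \<open>fock1 \<otimes> 'a\<close> with
  \<open>e\<^sub>1\<^sup>m \<otimes> (e\<^sub>1\<^sup>k \<otimes> \<eta>) = e\<^sub>1\<^sup>m\<^sup>+\<^sup>k \<otimes> \<eta>\<close>; see \<open>left_tensor_basis\<close>.\<close>

lift_definition left_tensor :: "nat \<Rightarrow> 'a::complex_hilbert ell2 \<Rightarrow> 'a ell2"
  is "\<lambda>m f k. if k < m then 0 else f (k - m)"
proof -
  fix m :: nat and f :: "nat \<Rightarrow> 'a"
  assume "summable (\<lambda>k. (norm (f k))\<^sup>2)"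
  thus "summable (\<lambda>k. (norm (if k < m then 0 else f (k - m)))\<^sup>2)"
    by (subst summable_iff_shift[symmetric, of _ m]) simp
qed

definition odometer_map ::
  "('a::complex_hilbert \<Rightarrow> 'a ell2) \<Rightarrow> ('a ell2 \<Rightarrow> 'a ell2) \<Rightarrow> bool" where
  "odometer_map L W \<longleftrightarrow> (\<forall>m \<eta>. W (fock_basis m \<otimes>\<^sub>F \<eta>) = left_tensor m (L \<eta>))"


subsection \<open>Adequacy\<close>

lemma scaleC_0_left [simp]: "0 *\<^sub>C (x::'a::complex_hilbert) = 0"
  using scaleC_of_real[of 0 x] by simp

lemma scaleC_1_left [simp]: "1 *\<^sub>C (x::'a::complex_hilbert) = x"
  using scaleC_of_real[of 1 x] by simp

lemma scaleC_0_right [simp]: "c *\<^sub>C (0::'a::complex_hilbert) = 0"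
  using norm_scaleC[of c "0::'a"] by simp

lemma fock_tensor_add_left: "(x + y) \<otimes>\<^sub>F \<eta> = x \<otimes>\<^sub>F \<eta> + y \<otimes>\<^sub>F \<eta>"
  by transfer (simp add: scaleC_add_left)

lemma fock_tensor_add_right: "x \<otimes>\<^sub>F (\<eta> + \<zeta>) = x \<otimes>\<^sub>F \<eta> + x \<otimes>\<^sub>F \<zeta>"
  by transfer (simp add: scaleC_add_right)

lemma fock_tensor_scaleC_left: "(c *\<^sub>C x) \<otimes>\<^sub>F \<eta> = c *\<^sub>C (x \<otimes>\<^sub>F \<eta>)"
  by transfer (simp add: scaleC_scaleC scaleC_complex_def)

lemma fock_tensor_scaleC_right: "x \<otimes>\<^sub>F (c *\<^sub>C \<eta>) = c *\<^sub>C (x \<otimes>\<^sub>F \<eta>)"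
  by transfer (simp add: scaleC_scaleC mult.commute)

lemma cinner_fock_tensor: "cinner (x \<otimes>\<^sub>F \<eta>) (y \<otimes>\<^sub>F \<zeta>) = cinner x y * cinner \<eta> \<zeta>"
  using summable_cinner_coord[of x y]
  by (simp add: cinner_ell2_def fock_tensor.rep_eq cinner_scaleC_left cinner_scaleC_right
      cinner_complex_def suminf_mult ac_simps)

lemma coord_sum: "coord (\<Sum>i\<in>A. f i) k = (\<Sum>i\<in>A. coord (f i) k)"
  by (induction A rule: infinite_finite_induct) (simp_all add: zero_ell2.rep_eq plus_ell2.rep_eq)

lemma coord_fock_basis_tensor: "coord (fock_basis m \<otimes>\<^sub>F \<eta>) k = (if k = m then \<eta> else 0)"
  by (simp add: fock_tensor.rep_eq fock_basis.rep_eq)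

lemma fock_basis_tensor_sums: "(\<lambda>m. fock_basis m \<otimes>\<^sub>F coord f m) sums f"
proof -
  have coord_part: "coord (\<Sum>m<n. fock_basis m \<otimes>\<^sub>F coord f m) k = (if k < n then coord f k else 0)"
    for n k
    by (simp add: coord_sum coord_fock_basis_tensor)
  have "(norm ((\<Sum>m<n. fock_basis m \<otimes>\<^sub>F coord f m) - f))\<^sup>2 = (\<Sum>k. (norm (coord f (k + n)))\<^sup>2)" for n
  proof -
    have "(norm ((\<Sum>m<n. fock_basis m \<otimes>\<^sub>F coord f m) - f))\<^sup>2
        = (\<Sum>k. if k < n then 0 else (norm (coord f k))\<^sup>2)"
      unfolding norm_ell2_sq by (rule suminf_cong) (simp add: minus_ell2.rep_eq coord_part)
    also have "\<dots> = (\<Sum>k. (norm (coord f (k + n)))\<^sup>2)"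
    proof -
      let ?h = "\<lambda>k. if k < n then 0 else (norm (coord f k))\<^sup>2"
      have "summable ?h"
        by (rule summable_comparison_test'[OF summable_coord[of f]]) auto
      from suminf_split_initial_segment[OF this, of n] show ?thesis by simp
    qed
    finally show ?thesis .
  qed
  moreover have "(\<lambda>n. \<Sum>k. (norm (coord f (k + n)))\<^sup>2) \<longlonglongrightarrow> 0"
    by (rule suminf_exist_split2) (rule summable_coord)
  ultimately have "(\<lambda>n. (norm ((\<Sum>m<n. fock_basis m \<otimes>\<^sub>F coord f m) - f))\<^sup>2) \<longlonglongrightarrow> 0"
    by simp
  hence "(\<lambda>n. norm ((\<Sum>m<n. fock_basis m \<otimes>\<^sub>F coord f m) - f)) \<longlonglongrightarrow> 0"
    using tendsto_real_sqrt by fastforce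
  thus ?thesis
    unfolding sums_def by (rule LIM_zero_cancel[OF tendsto_norm_zero_cancel])
qed

lemma fock_basis_orthonormal: "cinner (fock_basis i) (fock_basis j) = (if i = j then 1 else 0)"
proof -
  have "cinner (fock_basis i) (fock_basis j) = (\<Sum>k. if k = i then if i = j then 1 else 0 else 0)"
    unfolding cinner_ell2_def
    by (rule suminf_cong) (simp add: fock_basis.rep_eq cinner_complex_def)
  also have "\<dots> = (\<Sum>k\<in>{i}. if k = i then if i = j then 1 else 0 else 0)"
    by (rule suminf_finite) auto
  finally show ?thesis by simp
qed

lemma fock_basis_sums: "(\<lambda>m. coord x m *\<^sub>C fock_basis m) sums x"
proof -
  have "coord x m *\<^sub>C fock_basis m = fock_basis m \<otimes>\<^sub>F coord x m" for m
    by transfer (auto simp: scaleC_complex_def)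
  thus ?thesis using fock_basis_tensor_sums[of x] by simp
qed

lemma fock_tensor_total:
  "closure (span {x \<otimes>\<^sub>F \<eta> | x \<eta>. True}) = (UNIV :: 'a::complex_hilbert ell2 set)"
proof -
  have "f \<in> closure (span {x \<otimes>\<^sub>F \<eta> | x \<eta>. True})" for f :: "'a ell2"
    unfolding closure_sequential
  proof (intro exI conjI allI)
    show "(\<lambda>n. \<Sum>m<n. fock_basis m \<otimes>\<^sub>F coord f m) \<longlonglongrightarrow> f"
      using fock_basis_tensor_sums[of f] by (simp add: sums_def)
    show "(\<Sum>m<n. fock_basis m \<otimes>\<^sub>F coord f m) \<in> span {x \<otimes>\<^sub>F \<eta> | x \<eta>. True}" for n
      by (intro span_sum span_base) blast
  qed
  thus ?thesis by blast
qed

lemma left_tensor_basis: "left_tensor m (fock_basis k \<otimes>\<^sub>F \<eta>) = fock_basis (m + k) \<otimes>\<^sub>F \<eta>"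
  by (auto simp: coord_inject[symmetric] fun_eq_iff left_tensor.rep_eq coord_fock_basis_tensor)

lemma left_tensor_add: "left_tensor m (f + g) = left_tensor m f + left_tensor m g"
  by transfer auto

lemma left_tensor_scaleC: "left_tensor m (c *\<^sub>C f) = c *\<^sub>C left_tensor m f"
  by (simp add: coord_inject[symmetric] fun_eq_iff left_tensor.rep_eq scaleC_ell2.rep_eq)

lemma norm_left_tensor: "norm (left_tensor m f) = norm f"
proof -
  have "(norm (left_tensor m f))\<^sup>2 = (norm f)\<^sup>2"
    using suminf_split_initial_segment[OF summable_coord[of "left_tensor m f"], of m]
    by (simp add: norm_ell2_sq left_tensor.rep_eq)
  thus ?thesis by (simp add: power2_eq_iff_nonneg)
qed

lemma odometer_map_unique:
  assumes "odometer_map L W" "odometer_map L W'" "bounded_clinear W" "bounded_clinear W'"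
  shows "W = W'"
proof
  fix f
  have "(\<lambda>m. W (fock_basis m \<otimes>\<^sub>F coord f m)) sums W f"
    "(\<lambda>m. W' (fock_basis m \<otimes>\<^sub>F coord f m)) sums W' f"
    using assms(3,4)
    by (auto simp: bounded_clinear_def intro!: bounded_linear.sums[OF _ fock_basis_tensor_sums])
  thus "W f = W' f"
    using assms(1,2) by (simp add: odometer_map_def sums_unique2)
qed

end

(* W maps the bounded sequence e_1^m (x) \<eta> to e_1^m (x) L \<eta>. This sequence has constant norm
   |L \<eta>| but tends to 0 coordinatewise, so a norm convergent subsequence forces L \<eta> = 0. *)
theory Submission
  imports Defs
begin

lemma norm_fock_basis_tensor: "norm (fock_basis m \<otimes>\<^sub>F \<eta>) = norm \<eta>"
  by (simp add: norm_eq_sqrt_cinner cinner_fock_tensor fock_basis_orthonormal)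

lemma tendsto_coord:
  assumes "X \<longlonglongrightarrow> l"
  shows "(\<lambda>i. coord (X i) k) \<longlonglongrightarrow> coord l k"
proof -
  have "(\<lambda>i. norm (coord (X i) k - coord l k)) \<longlonglongrightarrow> 0"
  proof (rule Lim_null_comparison)
    show "(\<lambda>i. norm (X i - l)) \<longlonglongrightarrow> 0"
      using assms by (intro tendsto_norm_zero LIM_zero)
    show "\<forall>\<^sub>F i in sequentially. norm (norm (coord (X i) k - coord l k)) \<le> norm (X i - l)"
      using norm_coord_le[of "X _ - l" k] by (simp add: minus_ell2.rep_eq)
  qed
  thus ?thesis
    by (rule LIM_zero_cancel[OF tendsto_norm_zero_cancel])
qed

lemma left_tensor_subseq_limit_zero:
  assumes "strict_mono r" and lim: "(\<lambda>i. left_tensor (r i) f) \<longlonglongrightarrow> l"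
  shows "f = 0"
proof -
  have "coord l k = 0" for k
  proof (rule LIMSEQ_unique[OF tendsto_coord[OF lim]])
    have "\<forall>\<^sub>F i in sequentially. coord (left_tensor (r i) f) k = 0"
      using eventually_gt_at_top[of k]
      by eventually_elim
         (use seq_suble[OF assms(1)] in \<open>auto simp: left_tensor.rep_eq dest: less_le_trans\<close>)
    thus "(\<lambda>i. coord (left_tensor (r i) f) k) \<longlonglongrightarrow> 0"
      by (rule tendsto_eventually)
  qed
  hence "l = 0"
    by (simp add: coord_inject[symmetric] zero_ell2.rep_eq fun_eq_iff)
  with tendsto_norm[OF lim] have "(\<lambda>i. norm f) \<longlonglongrightarrow> 0"
    by (simp add: norm_left_tensor)
  thus ?thesis
    by (simp add: LIMSEQ_const_iff)
qed

lemma compact_odometer_symbol_unit: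
  assumes "odometer_map L W" "compact_operator W" "norm \<eta> \<le> 1"
  shows "L \<eta> = 0"
proof -
  have "left_tensor m (L \<eta>) \<in> closure (W ` cball 0 1)" for m
  proof -
    have "W (fock_basis m \<otimes>\<^sub>F \<eta>) \<in> W ` cball 0 1"
      using assms(3) by (intro imageI) (simp add: norm_fock_basis_tensor)
    thus ?thesis
      using assms(1) closure_subset unfolding odometer_map_def by fastforce
  qed
  moreover have "seq_compact (closure (W ` cball 0 1))"
    using assms(2) by (simp add: compact_operator_def compact_imp_seq_compact)
  ultimately obtain l r where "strict_mono (r :: nat \<Rightarrow> nat)"
    "((\<lambda>m. left_tensor m (L \<eta>)) \<circ> r) \<longlonglongrightarrow> l"
    using seq_compactE[of _ "\<lambda>m. left_tensor m (L \<eta>)"] by metis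
  thus ?thesis
    by (intro left_tensor_subseq_limit_zero) (auto simp: o_def)
qed

lemma compact_odometer_symbol:
  assumes "bounded_clinear L" "odometer_map L W" "compact_operator W"
  shows "L \<eta> = 0"
proof -
  interpret L: bounded_linear L
    using assms(1) by (simp add: bounded_clinear_def)
  have "L (sgn \<eta>) = 0"
    using assms(2,3) by (rule compact_odometer_symbol_unit) (simp add: norm_sgn)
  thus ?thesis
    using L.zero by (cases "\<eta> = 0") (auto simp: sgn_div_norm L.scaleR)
qed

lemma compact_operator_zero:
  "compact_operator (\<lambda>_ :: 'a::complex_hilbert. 0 :: 'b::complex_hilbert)"
proof -
  have "(\<lambda>_ :: 'a. 0 :: 'b) ` cball 0 1 = {0}"
    by (rule image_constant[of 0]) simp
  thus ?thesis
    by (simp add: compact_operator_def bounded_clinear_def bounded_linear_zero)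
qed

theorem proposition3p1:
  fixes L :: "'e::{complex_hilbert, second_countable_topology} \<Rightarrow> 'e ell2"
    and W :: "'e ell2 \<Rightarrow> 'e ell2"
  assumes "(UNIV :: 'e set) \<noteq> {0}"
    and "bounded_clinear L"
    and "odometer_map L W"
    and "bounded_clinear W"
  shows "compact_operator W \<longleftrightarrow> W = (\<lambda>_. 0)"
proof
  assume "compact_operator W"
  hence "L \<eta> = 0" for \<eta>
    using assms(2,3) by (intro compact_odometer_symbol)
  hence "odometer_map L (\<lambda>_. 0)"
    using norm_left_tensor[of _ "0 :: 'e ell2"] by (simp add: odometer_map_def)
  moreover have "bounded_clinear (\<lambda>_ :: 'e ell2. 0 :: 'e ell2)"
    by (simp add: bounded_clinear_def bounded_linear_zero)
  ultimately show "W = (\<lambda>_. 0)"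
    using assms(3,4) by (intro odometer_map_unique)
qed (simp add: compact_operator_zero)

end
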